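(* Let $f:\mathbb{R}^n\to\mathbb{R}$ be differentiable, $\mu$-strongly convex and $L$-smooth with minimizer $x^*$ and $f^*=f(x^* )$. Choose a constant learning rate $h\in\left(0,\frac1{\sqrt L}\right]$, let $w=\frac{h\sqrt\mu}{1+h\sqrt\mu}$, and let $x_k,v_k$ be generated from $x_0=v_0$ by $$y_k=(1-w)x_k+wv_k,$$ $$x_{k+1}-x_k=w(v_k-x_k)-\frac{h}{\sqrt L}(\nabla f(y_k)+e_k),$$ $$v_{k+1}-v_k=w(x_k-v_k)-\frac{h}{\sqrt\mu}(\nabla f(y_k)+e_k).$$ Let $E_k^{SC}=f(x_k)-f^*+\frac\mu2|v_k-x^*|^2$. Then, for all $k\ge0$, $$\mathbb{E}[E_k^{SC}]\le r^kE_0^{SC}+(1-r^k)\,h\,\frac{\sigma^2}{\sqrt\mu},\qquad r=1-h\sqrt\mu.$$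
   Context: $f$ is $L$-smooth if $f(y)-f(x)+\nabla f(x)\cdot(x-y)\le \frac L2|x-y|^2$ for all $x,y$. $f$ is $\mu$-strongly convex ($\mu>0$) if $f(x)+\nabla f(x)\cdot(y-x)\le f(y)-\frac\mu2|x-y|^2$ for all $x,y$. Stochastic gradient model: the stochastic gradient is $\widehat g(x,\xi)=\nabla f(x)+e(x,\xi)$, where for every $x$ one has $\mathbb{E}[e(x,\xi)]=0$ and $\mathrm{Var}(e(x,\xi))\le\sigma^2$, i.e. $\mathbb{E}[|e(x,\xi)|^2]\le\sigma^2$. At step $k$ the error is $e_k=e(y_k,\xi_k)$, with $\xi_k$ a fresh sample independent of the past, so that conditionally on the past (on $x_0,v_0,\xi_0,\dots,\xi_{k-1}$) $e_k$ has mean $0$ and $\mathbb{E}[|e_k|^2]\le\sigma^2$. The initial point is deterministic. Convention: $r^0=1$. *)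

theory Defs
  imports "HOL-Probability.Probability"
begin

text \<open>Only meaningful at points where \<open>f\<close> is differentiable; there the vector is unique.\<close>

definition grad :: "('a::euclidean_space \<Rightarrow> real) \<Rightarrow> 'a \<Rightarrow> 'a" where
  "grad f x = (THE g. GDERIV f x :> g)"

definition L_smooth :: "real \<Rightarrow> ('a::euclidean_space \<Rightarrow> real) \<Rightarrow> bool" where
  "L_smooth L f \<longleftrightarrow>
     (\<forall>x y. f y - f x + inner (grad f x) (x - y) \<le> L / 2 * (norm (x - y))\<^sup>2)"

definition strongly_convex :: "real \<Rightarrow> ('a::euclidean_space \<Rightarrow> real) \<Rightarrow> bool" where
  "strongly_convex \<mu> f \<longleftrightarrow> \<mu> > 0 \<and>
     (\<forall>x y. f x + inner (grad f x) (y - x) \<le> f y - \<mu> / 2 * (norm (x - y))\<^sup>2)"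

text \<open>
  \<open>D\<close> is the law of one sample \<open>\<xi>\<close>. Joint measurability in the point and the sample makes
  \<open>err (y \<omega>) (\<xi> \<omega>)\<close> a random variable whenever \<open>y\<close> and \<open>\<xi>\<close> are. The integrability clauses are
  needed because the Bochner integral of a non-integrable function is \<open>0\<close>.
\<close>

definition gradient_error ::
  "'s measure \<Rightarrow> real \<Rightarrow> ('a::euclidean_space \<Rightarrow> 's \<Rightarrow> 'a) \<Rightarrow> bool" where
  "gradient_error D \<sigma> err \<longleftrightarrow>
     (\<lambda>(x, s). err x s) \<in> borel_measurable (borel \<Otimes>\<^sub>M D) \<and>
     (\<forall>x. integrable D (err x) \<and> (LINT s|D. err x s) = 0 \<and>
          integrable D (\<lambda>s. (norm (err x s))\<^sup>2) \<and> (LINT s|D. (norm (err x s))\<^sup>2) \<le> \<sigma>\<^sup>2)"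

definition iid_samples :: "'w measure \<Rightarrow> 's measure \<Rightarrow> (nat \<Rightarrow> 'w \<Rightarrow> 's) \<Rightarrow> bool" where
  "iid_samples M D \<xi> \<longleftrightarrow>
     prob_space.indep_vars M (\<lambda>_. D) \<xi> UNIV \<and> (\<forall>k. distr M D (\<xi> k) = D)"

definition E_SC :: "('a::euclidean_space \<Rightarrow> real) \<Rightarrow> real \<Rightarrow> 'a \<Rightarrow> 'a \<Rightarrow> 'a \<Rightarrow> real" where
  "E_SC f \<mu> xstar x v = f x - f xstar + \<mu> / 2 * (norm (v - xstar))\<^sup>2"

end

theory Submission
  imports Defs
begin

text \<open>
  Along every trajectory the energy satisfies
  \<open>E (Suc k) \<le> r * E k + inner (u k) (e k) + h\<^sup>2 * (norm (e k))\<^sup>2\<close>, where \<open>u k\<close> depends only on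
  \<open>(x k, v k)\<close>. The function value \<open>f (x (Suc k))\<close> contributes at most
  \<open>- (h\<^sup>2 / 2) * (norm (grad f (y k)))\<^sup>2\<close>, which is exactly cancelled by the quadratic term of
  \<open>v (Suc k)\<close>, and the remaining terms contract by strong convexity towards the reference point and
  towards \<open>x k\<close>. Since \<open>(x k, v k)\<close> is a function of the first \<open>k\<close> samples, the linear term has
  expectation \<open>0\<close> and the quadratic one at most \<open>h\<^sup>2 * \<sigma>\<^sup>2 = (1 - r) * h * \<sigma>\<^sup>2 / sqrt \<mu>\<close>. Integrability
  propagates through the same inequality, because \<open>E\<close> is nonnegative and dominates \<open>(norm (u k))\<^sup>2\<close>
  up to a constant.
\<close>

section \<open>Quadratic bounds from strong convexity and smoothness\<close>

lemma norm_convex_comb_sq_le: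
  fixes u v :: "'a::real_inner"
  assumes "0 \<le> t" "t \<le> 1"
  shows "(norm ((1 - t) *\<^sub>R u + t *\<^sub>R v))\<^sup>2 \<le> (1 - t) * (norm u)\<^sup>2 + t * (norm v)\<^sup>2"
proof -
  have "(1 - t) * (norm u)\<^sup>2 + t * (norm v)\<^sup>2 - (norm ((1 - t) *\<^sub>R u + t *\<^sub>R v))\<^sup>2
      = t * (1 - t) * (norm (u - v))\<^sup>2"
    unfolding power2_norm_eq_inner by (simp add: inner_simps inner_commute algebra_simps)
  moreover have "0 \<le> t * (1 - t) * (norm (u - v))\<^sup>2"
    using assms by simp
  ultimately show ?thesis by linarith
qed

text \<open>Strong convexity and smoothness bound the same first-order remainder from below and
  above. Testing both on \<open>0\<close> and a unit vector leaves only the constants.\<close>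

lemma strongly_convex_le_smooth:
  fixes f :: "'a::euclidean_space \<Rightarrow> real"
  assumes "strongly_convex \<mu> f" "L_smooth L f"
  shows "\<mu> \<le> L"
proof -
  obtain b :: 'a where b: "b \<in> Basis" using nonempty_Basis by blast
  have "f 0 + inner (grad f 0) b \<le> f b - \<mu> / 2"
    using assms(1) b unfolding strongly_convex_def by (metis diff_zero diff_0 mult.right_neutral norm_Basis norm_minus_cancel one_power2)
  moreover have "f b - f 0 - inner (grad f 0) b \<le> L / 2"
    using assms(2) b unfolding L_smooth_def by (metis diff_conv_add_uminus diff_0 inner_minus_right mult.right_neutral norm_Basis norm_minus_cancel one_power2)
  ultimately show ?thesis by linarith
qed

text \<open>A gradient step of length \<open>1 / L\<close> from \<open>y\<close> lowers
  \<open>f\<close> by at least \<open>(norm (grad f y))\<^sup>2 / (2 * L)\<close>, and it cannot go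
  below the minimum.\<close>

lemma grad_sq_le_gap:
  fixes f :: "'a::euclidean_space \<Rightarrow> real"
  assumes "L_smooth L f" "L > 0" "\<And>z. f p \<le> f z"
  shows "(norm (grad f y))\<^sup>2 \<le> 2 * L * (f y - f p)"
proof -
  let ?g = "grad f y"
  have "f (y - (1 / L) *\<^sub>R ?g) - f y + inner ?g ((1 / L) *\<^sub>R ?g) \<le> L / 2 * (norm ((1 / L) *\<^sub>R ?g))\<^sup>2"
    using assms(1)[unfolded L_smooth_def, rule_format, of "y - (1 / L) *\<^sub>R ?g" y] by simp
  hence "f (y - (1 / L) *\<^sub>R ?g) - f y + (1 / L) * (norm ?g)\<^sup>2 \<le> L / 2 * ((1 / L)\<^sup>2 * (norm ?g)\<^sup>2)"
    by (simp add: power2_norm_eq_inner[symmetric] power_mult_distrib power_divide)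
  also have "\<dots> = (1 / (2 * L)) * (norm ?g)\<^sup>2"
    using assms(2) by (simp add: field_simps power2_eq_square)
  finally have "(1 / L) * (norm ?g)\<^sup>2 - (1 / (2 * L)) * (norm ?g)\<^sup>2 \<le> f y - f p"
    using assms(3)[of "y - (1 / L) *\<^sub>R ?g"] by linarith
  thus ?thesis using assms(2) by (simp add: field_simps)
qed

text \<open>The gradient vanishes at the minimizer, by the preceding bound taken at \<open>p\<close>
  itself, so both defining inequalities lose their linear term there.\<close>

lemma gap_bounds:
  fixes f :: "'a::euclidean_space \<Rightarrow> real"
  assumes "strongly_convex \<mu> f" "L_smooth L f" "L > 0" "\<And>z. f p \<le> f z"
  shows "\<mu> / 2 * (norm (z - p))\<^sup>2 \<le> f z - f p" "f z - f p \<le> L / 2 * (norm (z - p))\<^sup>2"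
proof -
  have "grad f p = 0" using grad_sq_le_gap[OF assms(2-4), of p] by simp
  thus "\<mu> / 2 * (norm (z - p))\<^sup>2 \<le> f z - f p" "f z - f p \<le> L / 2 * (norm (z - p))\<^sup>2"
    using assms(1)[unfolded strongly_convex_def, THEN conjunct2, rule_format, of p z]
      assms(2)[unfolded L_smooth_def, rule_format, of z p]
    by (simp_all add: norm_minus_commute)
qed

text \<open>This keeps the contraction factor \<open>1 - h * sqrt \<mu>\<close> nonnegative. It
  rests on \<open>\<mu> \<le> L\<close>; for \<open>h \<le> 0\<close> the product is nonpositive
  anyway.\<close>

lemma mult_sqrt_le_one:
  fixes f :: "'a::euclidean_space \<Rightarrow> real"
  assumes "strongly_convex \<mu> f" "L_smooth L f" "L > 0" "h \<le> 1 / sqrt L"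
  shows "h * sqrt \<mu> \<le> 1"
proof -
  have "h * sqrt L \<le> 1" using assms(3,4) by (simp add: field_simps)
  moreover have "h * sqrt \<mu> \<le> h * sqrt L" if "0 \<le> h"
    using strongly_convex_le_smooth[OF assms(1,2)] that by (simp add: mult_left_mono)
  moreover have "h * sqrt \<mu> \<le> 0" if "h \<le> 0"
    using that assms(1) by (simp add: strongly_convex_def mult_nonpos_nonneg)
  ultimately show ?thesis by linarith
qed

section \<open>Pathwise energy estimate for one step\<close>

text \<open>No probability enters: \<open>e\<close> is any vector. Both squared updates carry
  \<open>h\<^sup>2 / 2 * (norm (g + e))\<^sup>2\<close> with \<open>g = grad f y\<close>; together
  they produce \<open>h\<^sup>2 * (norm e)\<^sup>2\<close> and the \<open>2 * h\<^sup>2\<close> in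
  the coefficient of \<open>e\<close>. The \<open>- h / sqrt L\<close> there comes from the descent
  of \<open>f\<close>, the last vector from the expansion of \<open>v' - p\<close>.\<close>

lemma E_SC_step:
  fixes f :: "'a::euclidean_space \<Rightarrow> real" and p x y v x' v' e :: 'a
  assumes sc: "strongly_convex \<mu> f" and sm: "L_smooth L f" and L: "L > 0"
    and h: "0 < h" "h \<le> 1 / sqrt L"
    and w: "w = h * sqrt \<mu> / (1 + h * sqrt \<mu>)"
    and y: "y = (1 - w) *\<^sub>R x + w *\<^sub>R v"
    and x': "x' - x = w *\<^sub>R (v - x) - (h / sqrt L) *\<^sub>R (grad f y + e)"
    and v': "v' - v = w *\<^sub>R (x - v) - (h / sqrt \<mu>) *\<^sub>R (grad f y + e)"
  shows "E_SC f \<mu> p x' v' \<le> (1 - h * sqrt \<mu>) * E_SC f \<mu> p x v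
    + inner ((2 * h\<^sup>2 - h / sqrt L) *\<^sub>R grad f y - (h * sqrt \<mu>) *\<^sub>R (v + w *\<^sub>R (x - v) - p)) e
    + h\<^sup>2 * (norm e)\<^sup>2"
proof -
  define a where "a = h * sqrt \<mu>"
  define g where "g = grad f y"
  define z where "z = v + w *\<^sub>R (x - v)"
  define d where "d = v - y"
  have \<mu>: "\<mu> > 0" using sc by (simp add: strongly_convex_def)
  have a: "0 < a" "a \<le> 1"
    using mult_sqrt_le_one[OF sc sm L h(2)] h(1) \<mu> by (auto simp: a_def)
  have w1: "1 - w = 1 / (1 + a)" "w = a / (1 + a)"
    using a by (auto simp: w a_def[symmetric] field_simps)
  text \<open>The choice of \<open>w\<close> makes \<open>y\<close> divide the segment so that \<open>x - y = - a (v - y)\<close>.\<close>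
  have d: "d = (1 - w) *\<^sub>R (v - x)" by (simp add: d_def y algebra_simps)
  have wa: "w = a * (1 - w)" using a by (simp add: w1(1)) (simp add: w1)
  have xy: "x - y = - (a *\<^sub>R d)"
    using wa by (simp add: y d algebra_simps) (metis scaleR_left_distrib add.commute)
  \<comment> \<open>\<open>z\<close> is \<open>v'\<close> before its gradient step. It moves
    \<open>v\<close> by the fraction \<open>a\<close> towards \<open>y\<close>, and this gives the
    factor \<open>1 - a\<close> in front of the distance term.\<close>
  have zy: "z = (1 - a) *\<^sub>R v + a *\<^sub>R y"
  proof -
    have "z - v = - (w *\<^sub>R (v - x))" by (simp add: z_def algebra_simps)
    also have "\<dots> = - (a *\<^sub>R d)" using wa by (simp add: d)
    finally show ?thesis by (simp add: d_def algebra_simps)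
  qed
  \<comment> \<open>As \<open>y = x + w *\<^sub>R (v - x)\<close>, the point \<open>x'\<close> is a
    pure gradient step from \<open>y\<close>. The length \<open>h / sqrt L\<close> turns the factor
    \<open>L / 2\<close> of smoothness into \<open>h\<^sup>2 / 2\<close>.\<close>
  have fx': "f x' \<le> f y - (h / sqrt L) * inner g (g + e) + h\<^sup>2 / 2 * (norm (g + e))\<^sup>2"
  proof -
    have yx': "y - x' = (h / sqrt L) *\<^sub>R (g + e)"
      using x' by (simp add: y g_def algebra_simps)
    have "L / 2 * (norm (y - x'))\<^sup>2 = h\<^sup>2 / 2 * (norm (g + e))\<^sup>2"
      using L unfolding yx' by (simp add: power_mult_distrib power_divide)
    moreover have "inner g (y - x') = (h / sqrt L) * inner g (g + e)"
      unfolding yx' by simp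
    moreover have "f x' - f y + inner g (y - x') \<le> L / 2 * (norm (y - x'))\<^sup>2"
      using sm by (simp add: L_smooth_def g_def)
    ultimately show ?thesis by linarith
  qed
  have nv': "\<mu> / 2 * (norm (v' - p))\<^sup>2
      = \<mu> / 2 * (norm (z - p))\<^sup>2 - a * inner (z - p) (g + e) + h\<^sup>2 / 2 * (norm (g + e))\<^sup>2"
  proof -
    have v'p: "v' - p = (z - p) - (h / sqrt \<mu>) *\<^sub>R (g + e)"
      using v' by (simp add: z_def g_def algebra_simps)
    have "(norm (q - c *\<^sub>R q'))\<^sup>2 = (norm q)\<^sup>2 - 2 * c * inner q q' + c\<^sup>2 * (norm q')\<^sup>2"
      for c and q q' :: 'a
      unfolding power2_norm_eq_inner
      by (simp add: inner_diff_left inner_diff_right inner_commute power2_eq_square algebra_simps)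
    from this[of "z - p" "h / sqrt \<mu>" "g + e", folded v'p]
    have "\<mu> / 2 * (norm (v' - p))\<^sup>2
      = \<mu> / 2 * (norm (z - p))\<^sup>2 - (\<mu> * (h / sqrt \<mu>)) * inner (z - p) (g + e)
        + (\<mu> * (h / sqrt \<mu>)\<^sup>2) / 2 * (norm (g + e))\<^sup>2"
      by (simp only:) (simp add: ring_distribs)
    moreover have "\<mu> * (h / sqrt \<mu>) = a"
      using \<mu> by (simp add: a_def real_div_sqrt field_simps)
    moreover have "\<mu> * (h / sqrt \<mu>)\<^sup>2 = h\<^sup>2"
      using \<mu> by (simp add: power_divide)
    ultimately show ?thesis by (simp only:)
  qed
  \<comment> \<open>The only use of \<open>h \<le> 1 / sqrt L\<close> beyond
    \<open>a \<le> 1\<close>: descent pays for the squared gradients of both updates.\<close>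
  have hh: "h\<^sup>2 * inner g g \<le> h / sqrt L * inner g g"
    using mult_left_mono[OF h(2), of h] h(1) by (intro mult_right_mono) (auto simp: power2_eq_square)
  define nz nv ny where "nz = \<mu> / 2 * (norm (z - p))\<^sup>2" and "nv = \<mu> / 2 * (norm (v - p))\<^sup>2"
    and "ny = \<mu> / 2 * (norm (y - p))\<^sup>2"
  have cvx: "nz \<le> (1 - a) * nv + a * ny"
  proof -
    have "z - p = (1 - a) *\<^sub>R (v - p) + a *\<^sub>R (y - p)"
      by (simp add: zy algebra_simps)
    hence "(norm (z - p))\<^sup>2 \<le> (1 - a) * (norm (v - p))\<^sup>2 + a * (norm (y - p))\<^sup>2"
      using norm_convex_comb_sq_le[of a] a by simp
    from mult_left_mono[OF this, of "\<mu> / 2"] show ?thesis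
      using \<mu> by (simp add: nz_def nv_def ny_def distrib_left mult.left_commute)
  qed
  \<comment> \<open>Strong convexity is applied at \<open>y\<close> in two directions: towards
    \<open>x\<close> with weight \<open>1 - a\<close>, dropping the quadratic gain, and towards
    \<open>p\<close> with weight \<open>a\<close>, keeping it.\<close>
  have sc_at: "f y + inner g (q - y) \<le> f q - \<mu> / 2 * (norm (y - q))\<^sup>2" for q
    using sc by (simp add: strongly_convex_def g_def)
  have "f y + inner g (x - y) \<le> f x - \<mu> / 2 * (norm (y - x))\<^sup>2"
    by (rule sc_at)
  also have "\<dots> \<le> f x" using \<mu> by simp
  finally have "f y - a * inner g d \<le> f x" by (simp add: xy)
  hence fx: "(1 - a) * (f y - a * inner g d) \<le> (1 - a) * f x"
    using a by (intro mult_left_mono) auto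
  have fp: "a * (f y + inner g (p - y)) \<le> a * (f p - ny)"
    using a sc_at[of p] unfolding ny_def by (intro mult_left_mono) auto
  have zp: "inner (z - p) (g + e) = inner (z - p) e - inner g (p - y) + (1 - a) * inner g d"
    by (simp add: zy d_def inner_simps inner_commute algebra_simps)
  have ge: "inner g (g + e) = inner g g + inner g e"
    "(norm (g + e))\<^sup>2 = inner g g + 2 * inner g e + (norm e)\<^sup>2"
    by (simp_all add: power2_norm_eq_inner inner_simps inner_commute)
  have "E_SC f \<mu> p x' v'
      \<le> f y - f p - (h / sqrt L) * inner g (g + e) + h\<^sup>2 * (norm (g + e))\<^sup>2
        + nz - a * inner (z - p) (g + e)"
    unfolding E_SC_def nz_def using fx' nv' by linarith
  \<comment> \<open>Split \<open>f y\<close> with weights \<open>1 - a\<close> and \<open>a\<close>.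
    By \<open>zp\<close>, the term \<open>- a * inner (z - p) (g + e)\<close> supplies exactly the
    linear terms of \<open>fx\<close> and \<open>fp\<close>; the \<open>a * ny\<close> of
    \<open>cvx\<close> cancels against that of \<open>fp\<close>, and \<open>hh\<close> absorbs
    \<open>inner g g\<close>.\<close>
  also have "\<dots> \<le> (1 - a) * E_SC f \<mu> p x v
      + ((2 * h\<^sup>2 - h / sqrt L) * inner g e - a * inner (z - p) e) + h\<^sup>2 * (norm e)\<^sup>2"
    using hh cvx fx fp unfolding zp ge E_SC_def nv_def[symmetric] by (simp add: algebra_simps)
  finally show ?thesis
    by (simp add: a_def[symmetric] g_def[symmetric] z_def[symmetric] inner_diff_left inner_add_left)
qed

text \<open>Serves to make the coefficient of \<open>e\<close> square integrable; what matters is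
  that the bound is linear in the energy. The energy controls \<open>x - p\<close> by quadratic
  growth of \<open>f\<close> and \<open>v - p\<close> by definition, hence also their convex
  combinations, and the gradient at \<open>y\<close> is controlled by \<open>y - p\<close>.\<close>

lemma step_coefficient_bound:
  fixes f :: "'a::euclidean_space \<Rightarrow> real" and p x v y :: 'a and \<alpha> \<beta> :: real
  assumes sc: "strongly_convex \<mu> f" and sm: "L_smooth L f" and L: "L > 0" and p: "\<And>z. f p \<le> f z"
    and w: "0 \<le> w" "w \<le> 1" and y: "y = (1 - w) *\<^sub>R x + w *\<^sub>R v"
  shows "(norm (\<alpha> *\<^sub>R grad f y - \<beta> *\<^sub>R (v + w *\<^sub>R (x - v) - p)))\<^sup>2
    \<le> 2 * (\<alpha>\<^sup>2 * L\<^sup>2 + \<beta>\<^sup>2) * (2 / \<mu>) * E_SC f \<mu> p x v"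
proof -
  have \<mu>: "\<mu> > 0" using sc by (simp add: strongly_convex_def)
  define K where "K = (2 / \<mu>) * E_SC f \<mu> p x v"
  have x: "(norm (x - p))\<^sup>2 \<le> K"
  proof -
    have "\<mu> / 2 * (norm (x - p))\<^sup>2 \<le> E_SC f \<mu> p x v"
      using gap_bounds(1)[OF sc sm L p, of x] \<mu> by (simp add: E_SC_def add_increasing2)
    thus ?thesis using \<mu> by (simp add: K_def field_simps)
  qed
  have v: "(norm (v - p))\<^sup>2 \<le> K"
  proof -
    have "\<mu> / 2 * (norm (v - p))\<^sup>2 \<le> E_SC f \<mu> p x v"
      using p[of x] by (simp add: E_SC_def)
    thus ?thesis using \<mu> by (simp add: K_def field_simps)
  qed
  have comb: "(norm ((1 - w) *\<^sub>R q + w *\<^sub>R q'))\<^sup>2 \<le> K"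
    if "(norm q)\<^sup>2 \<le> K" "(norm q')\<^sup>2 \<le> K" for q q' :: 'a
  proof -
    have "(norm ((1 - w) *\<^sub>R q + w *\<^sub>R q'))\<^sup>2 \<le> (1 - w) * (norm q)\<^sup>2 + w * (norm q')\<^sup>2"
      by (rule norm_convex_comb_sq_le[OF w])
    also have "\<dots> \<le> (1 - w) * K + w * K"
      using w that by (intro add_mono mult_left_mono) auto
    finally show ?thesis by (simp add: algebra_simps)
  qed
  have "y - p = (1 - w) *\<^sub>R (x - p) + w *\<^sub>R (v - p)"
    by (simp add: y algebra_simps)
  hence yp: "(norm (y - p))\<^sup>2 \<le> K" using comb[OF x v] by simp
  have "v + w *\<^sub>R (x - v) - p = (1 - w) *\<^sub>R (v - p) + w *\<^sub>R (x - p)"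
    by (simp add: algebra_simps)
  hence zp: "(norm (v + w *\<^sub>R (x - v) - p))\<^sup>2 \<le> K" using comb[OF v x] by simp
  have g: "(norm (grad f y))\<^sup>2 \<le> L\<^sup>2 * K"
  proof -
    have "(norm (grad f y))\<^sup>2 \<le> 2 * L * (f y - f p)"
      by (rule grad_sq_le_gap[OF sm L p])
    also have "\<dots> \<le> 2 * L * (L / 2 * K)"
      using order_trans[OF gap_bounds(2)[OF sc sm L p, of y] mult_left_mono[OF yp, of "L / 2"]] L
      by (intro mult_left_mono) auto
    finally show ?thesis by (simp add: power2_eq_square)
  qed
  \<comment> \<open>The parallelogram identity with one square dropped.\<close>
  have par: "(norm (q - q'))\<^sup>2 \<le> 2 * (norm q)\<^sup>2 + 2 * (norm q')\<^sup>2" for q q' :: 'a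
  proof -
    have "2 * (norm q)\<^sup>2 + 2 * (norm q')\<^sup>2 - (norm (q - q'))\<^sup>2 = (norm (q + q'))\<^sup>2"
      unfolding power2_norm_eq_inner by (simp add: inner_simps inner_commute)
    thus ?thesis by (smt (verit) zero_le_power2)
  qed
  have "(norm (\<alpha> *\<^sub>R grad f y - \<beta> *\<^sub>R (v + w *\<^sub>R (x - v) - p)))\<^sup>2
      \<le> 2 * (\<alpha>\<^sup>2 * (norm (grad f y))\<^sup>2) + 2 * (\<beta>\<^sup>2 * (norm (v + w *\<^sub>R (x - v) - p))\<^sup>2)"
    using par[of "\<alpha> *\<^sub>R grad f y" "\<beta> *\<^sub>R (v + w *\<^sub>R (x - v) - p)"]
    by (simp add: power_mult_distrib)
  also have "\<dots> \<le> 2 * (\<alpha>\<^sup>2 * (L\<^sup>2 * K)) + 2 * (\<beta>\<^sup>2 * K)"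
    using g zp by (intro add_mono mult_left_mono) auto
  finally show ?thesis by (simp add: K_def algebra_simps)
qed

section \<open>Existence and measurability of the gradient\<close>

text \<open>The derivative is a linear functional, represented by the vector of its values on the
  basis. Uniqueness of the derivative makes this vector the one picked by
  \<open>THE\<close>.\<close>

lemma GDERIV_grad:
  fixes f :: "'a::euclidean_space \<Rightarrow> real"
  assumes "f differentiable (at z)"
  shows "GDERIV f z :> grad f z"
proof -
  obtain f' where f': "(f has_derivative f') (at z)"
    using assms by (auto simp: differentiable_def)
  then interpret bounded_linear f' by (rule has_derivative_bounded_linear)
  have "f' = (\<lambda>h. inner h (\<Sum>b\<in>Basis. f' b *\<^sub>R b))"
  proof
    fix h
    have "f' h = f' (\<Sum>b\<in>Basis. inner h b *\<^sub>R b)" by (simp add: euclidean_representation)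
    thus "f' h = inner h (\<Sum>b\<in>Basis. f' b *\<^sub>R b)"
      by (simp add: sum scaleR inner_sum_right mult.commute)
  qed
  with f' have ex: "GDERIV f z :> (\<Sum>b\<in>Basis. f' b *\<^sub>R b)"
    unfolding gderiv_def by metis
  show ?thesis unfolding grad_def
  proof (rule theI)
    show "GDERIV f z :> (\<Sum>b\<in>Basis. f' b *\<^sub>R b)" by (rule ex)
  next
    fix g assume "GDERIV f z :> g"
    with ex show "g = (\<Sum>b\<in>Basis. f' b *\<^sub>R b)"
      unfolding gderiv_def using has_derivative_unique
      by (metis inner_commute vector_eq_ldot)
  qed
qed

text \<open>Differentiability alone does not make the gradient continuous, but each coordinate is a
  pointwise limit of difference quotients, which are continuous in the point.\<close>

lemma borel_measurable_grad:
  fixes f :: "'a::euclidean_space \<Rightarrow> real"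
  assumes "\<And>z. f differentiable (at z)"
  shows "grad f \<in> borel_measurable borel"
proof (subst borel_measurable_euclidean_space, intro ballI)
  fix b :: 'a assume "b \<in> Basis"
  have cont: "continuous_on UNIV f"
    using assms by (simp add: differentiable_imp_continuous_on differentiable_on_def)
  have lim: "(\<lambda>n. (f (z + (1 / real (Suc n)) *\<^sub>R b) - f z) * real (Suc n)) \<longlonglongrightarrow> inner (grad f z) b" for z
  proof -
    have "((\<lambda>t. f (z + t *\<^sub>R b)) has_derivative (\<lambda>t. inner (t *\<^sub>R b) (grad f z))) (at 0)"
    proof -
      have "((\<lambda>t. z + t *\<^sub>R b) has_derivative (\<lambda>t. t *\<^sub>R b)) (at 0)"
        by (auto intro!: derivative_eq_intros)
      moreover have "(f has_derivative (\<lambda>k. inner k (grad f z))) (at (z + 0 *\<^sub>R b))"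
        using GDERIV_grad[OF assms, of z] by (simp add: gderiv_def)
      ultimately show ?thesis by (rule has_derivative_compose)
    qed
    hence "DERIV (\<lambda>t. f (z + t *\<^sub>R b)) 0 :> inner b (grad f z)"
      by (simp add: has_field_derivative_def mult_commute_abs)
    hence "((\<lambda>t. (f (z + t *\<^sub>R b) - f z) / t) \<longlongrightarrow> inner b (grad f z)) (at 0)"
      by (simp add: DERIV_def)
    moreover have "filterlim (\<lambda>n. 1 / real (Suc n)) (at 0) sequentially"
      using LIMSEQ_inverse_real_of_nat by (intro filterlim_atI) (auto simp: inverse_eq_divide)
    ultimately have "(\<lambda>n. (f (z + (1 / real (Suc n)) *\<^sub>R b) - f z) / (1 / real (Suc n))) \<longlonglongrightarrow> inner b (grad f z)"
      by (rule filterlim_compose)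
    thus ?thesis by (simp add: inner_commute)
  qed
  have "(\<lambda>z. (f (z + (1 / real (Suc n)) *\<^sub>R b) - f z) * real (Suc n)) \<in> borel_measurable borel" for n
    by (intro borel_measurable_continuous_onI continuous_intros continuous_on_compose2[OF cont]) auto
  thus "(\<lambda>z. inner (grad f z) b) \<in> borel_measurable borel"
    by (rule borel_measurable_LIMSEQ_real[OF lim])
qed

section \<open>Noise independent of the past\<close>

text \<open>Fubini takes the place of conditional expectation. With \<open>Z\<close> the past and
  \<open>X\<close> the fresh sample, the product form of the joint law lets the sample be integrated
  out at a frozen past, where \<open>Y\<close> and \<open>u\<close> are constants and the moment
  assumptions on \<open>err\<close> apply.\<close>

lemma gradient_error_independent:
  fixes err :: "'a::euclidean_space \<Rightarrow> 's \<Rightarrow> 'a" and Y u :: "'b \<Rightarrow> 'a"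
  assumes "prob_space M"
    and Zm[measurable]: "Z \<in> measurable M N" and Xm[measurable]: "X \<in> measurable M D"
    and X: "distr M D X = D"
    and joint: "distr M N Z \<Otimes>\<^sub>M D = distr M (N \<Otimes>\<^sub>M D) (\<lambda>\<omega>. (Z \<omega>, X \<omega>))"
    and err: "gradient_error D \<sigma> err"
    and Y[measurable]: "Y \<in> borel_measurable N" and u[measurable]: "u \<in> borel_measurable N"
    and u_sq: "integrable M (\<lambda>\<omega>. (norm (u (Z \<omega>)))\<^sup>2)"
  shows "integrable M (\<lambda>\<omega>. (norm (err (Y (Z \<omega>)) (X \<omega>)))\<^sup>2)"
    and "(LINT \<omega>|M. (norm (err (Y (Z \<omega>)) (X \<omega>)))\<^sup>2) \<le> \<sigma>\<^sup>2"
    and "integrable M (\<lambda>\<omega>. inner (u (Z \<omega>)) (err (Y (Z \<omega>)) (X \<omega>)))"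
    and "(LINT \<omega>|M. inner (u (Z \<omega>)) (err (Y (Z \<omega>)) (X \<omega>))) = 0"
proof -
  interpret M: prob_space M by fact
  let ?Q = "distr M N Z"
  interpret Q: prob_space ?Q by (rule M.prob_space_distr) fact
  interpret D: prob_space D using M.prob_space_distr[OF Xm] X by simp
  interpret QD: pair_prob_space ?Q D ..
  have err_meas[measurable]: "(\<lambda>(x, s). err x s) \<in> borel_measurable (borel \<Otimes>\<^sub>M D)"
    using err by (simp add: gradient_error_def)
  have em[measurable]: "(\<lambda>q. err (Y (fst q)) (snd q)) \<in> borel_measurable (N \<Otimes>\<^sub>M D)"
    using measurable_compose[OF _ err_meas, of "\<lambda>q. (Y (fst q), snd q)" "N \<Otimes>\<^sub>M D"] by simp
  have err_int: "integrable D (err x)" "(LINT s|D. err x s) = 0"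
    "integrable D (\<lambda>s. (norm (err x s))\<^sup>2)" "(LINT s|D. (norm (err x s))\<^sup>2) \<le> \<sigma>\<^sup>2" for x
    using err by (simp_all add: gradient_error_def)
  have to_M: "integrable (?Q \<Otimes>\<^sub>M D) \<phi> \<longleftrightarrow> integrable M (\<lambda>\<omega>. \<phi> (Z \<omega>, X \<omega>))"
    "integral\<^sup>L (?Q \<Otimes>\<^sub>M D) \<phi> = (LINT \<omega>|M. \<phi> (Z \<omega>, X \<omega>))"
    if "\<phi> \<in> borel_measurable (N \<Otimes>\<^sub>M D)" for \<phi> :: "'b \<times> 's \<Rightarrow> real"
    unfolding joint using that by (simp_all add: integrable_distr_eq integral_distr)
  let ?sq = "\<lambda>q. (norm (err (Y (fst q)) (snd q)))\<^sup>2"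
  let ?in = "\<lambda>q. inner (u (fst q)) (err (Y (fst q)) (snd q))"
  have sq_meas: "?sq \<in> borel_measurable (N \<Otimes>\<^sub>M D)" by measurable
  have in_meas: "?in \<in> borel_measurable (N \<Otimes>\<^sub>M D)" by measurable
  have sq_inner_meas: "(\<lambda>z. LINT s|D. (norm (err (Y z) s))\<^sup>2) \<in> borel_measurable N"
    using D.borel_measurable_lebesgue_integral[of "\<lambda>z s. (norm (err (Y z) s))\<^sup>2" N] sq_meas
    by (simp add: case_prod_beta')
  \<comment> \<open>The inner second moment is bounded by \<open>\<sigma>\<^sup>2\<close> under a
    probability law. This finite iterated integral is what yields integrability over the
    product.\<close>
  have sq_inner: "integrable ?Q (\<lambda>z. LINT s|D. (norm (err (Y z) s))\<^sup>2)"
    using sq_inner_meas err_int(4)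
    by (intro Q.integrable_const_bound[where B="\<sigma>\<^sup>2"]) auto
  have sq_int: "integrable (?Q \<Otimes>\<^sub>M D) ?sq"
    using sq_meas sq_inner err_int(3) by (intro QD.Fubini_integrable) auto
  thus sq_M: "integrable M (\<lambda>\<omega>. (norm (err (Y (Z \<omega>)) (X \<omega>)))\<^sup>2)"
    using to_M(1)[OF sq_meas] by simp
  have "(LINT \<omega>|M. (norm (err (Y (Z \<omega>)) (X \<omega>)))\<^sup>2) = integral\<^sup>L (?Q \<Otimes>\<^sub>M D) ?sq"
    using to_M(2)[OF sq_meas] by simp
  also have "\<dots> = (LINT z|?Q. LINT s|D. (norm (err (Y z) s))\<^sup>2)"
    using QD.integral_fst'[OF sq_int] by simp
  also have "\<dots> \<le> (LINT z|?Q. \<sigma>\<^sup>2)"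
    using sq_inner err_int(4) by (intro integral_mono) auto
  finally show "(LINT \<omega>|M. (norm (err (Y (Z \<omega>)) (X \<omega>)))\<^sup>2) \<le> \<sigma>\<^sup>2"
    using Q.prob_space by simp
  show in_M: "integrable M (\<lambda>\<omega>. inner (u (Z \<omega>)) (err (Y (Z \<omega>)) (X \<omega>)))"
  proof (rule Bochner_Integration.integrable_bound)
    show "integrable M (\<lambda>\<omega>. (norm (u (Z \<omega>)))\<^sup>2 + (norm (err (Y (Z \<omega>)) (X \<omega>)))\<^sup>2)"
      using u_sq sq_M by simp
    show "(\<lambda>\<omega>. inner (u (Z \<omega>)) (err (Y (Z \<omega>)) (X \<omega>))) \<in> borel_measurable M"
      using measurable_compose[OF _ in_meas, of "\<lambda>\<omega>. (Z \<omega>, X \<omega>)" M] by simp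
    have "\<bar>inner p q\<bar> \<le> (norm p)\<^sup>2 + (norm q)\<^sup>2" for p q :: 'a
    proof -
      have "\<bar>inner p q\<bar> \<le> norm p * norm q" by (rule Cauchy_Schwarz_ineq2)
      also have "\<dots> \<le> 2 * norm p * norm q" by simp
      also have "\<dots> \<le> (norm p)\<^sup>2 + (norm q)\<^sup>2" by (rule sum_squares_bound)
      finally show ?thesis .
    qed
    thus "AE \<omega> in M. norm (inner (u (Z \<omega>)) (err (Y (Z \<omega>)) (X \<omega>)))
        \<le> norm ((norm (u (Z \<omega>)))\<^sup>2 + (norm (err (Y (Z \<omega>)) (X \<omega>)))\<^sup>2)"
      by simp
  qed
  have in_int: "integrable (?Q \<Otimes>\<^sub>M D) ?in"
    using in_M to_M(1)[OF in_meas] by simp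
  have "(LINT \<omega>|M. inner (u (Z \<omega>)) (err (Y (Z \<omega>)) (X \<omega>))) = integral\<^sup>L (?Q \<Otimes>\<^sub>M D) ?in"
    using to_M(2)[OF in_meas] by simp
  also have "\<dots> = (LINT z|?Q. LINT s|D. inner (u z) (err (Y z) s))"
    using QD.integral_fst'[OF in_int] by simp
  also have "\<dots> = 0" using err_int(1,2) by simp
  finally show "(LINT \<omega>|M. inner (u (Z \<omega>)) (err (Y (Z \<omega>)) (X \<omega>))) = 0" .
qed

text \<open>Independence of the disjoint index blocks \<open>{..<k}\<close> and \<open>{k}\<close>,
  written as a product of laws ready for Fubini. The second block is a function on a singleton, so
  evaluation at \<open>k\<close> is pushed through the product.\<close>

lemma iid_samples_past_indep:
  fixes \<xi> :: "nat \<Rightarrow> 'w \<Rightarrow> 's"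
  assumes "prob_space M" "iid_samples M D \<xi>"
  defines "P \<equiv> \<lambda>k. PiM {..<k} (\<lambda>_. D)" and "past \<equiv> \<lambda>k \<omega>. \<lambda>i\<in>{..<k}. \<xi> i \<omega>"
  shows "past k \<in> measurable M (P k)" "\<xi> k \<in> measurable M D"
    and "distr M (P k) (past k) \<Otimes>\<^sub>M D = distr M (P k \<Otimes>\<^sub>M D) (\<lambda>\<omega>. (past k \<omega>, \<xi> k \<omega>))"
proof -
  interpret prob_space M by fact
  let ?K = "PiM {k} (\<lambda>_. D)" and ?now = "\<lambda>\<omega>. \<lambda>i\<in>{k}. \<xi> i \<omega>"
  have "indep_var (P k) (past k) ?K ?now"
    unfolding P_def past_def using assms(2)
    by (intro indep_var_restrict[of "\<lambda>_. D" \<xi> UNIV]) (auto simp: iid_samples_def)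
  hence past[measurable]: "past k \<in> measurable M (P k)" and now[measurable]: "?now \<in> measurable M ?K"
    and joint: "distr M (P k) (past k) \<Otimes>\<^sub>M distr M ?K ?now = distr M (P k \<Otimes>\<^sub>M ?K) (\<lambda>\<omega>. (past k \<omega>, ?now \<omega>))"
    by (simp_all only: indep_var_distribution_eq)
  show "past k \<in> measurable M (P k)" by (rule past)
  have proj[measurable]: "(\<lambda>p. p k) \<in> measurable ?K D" by simp
  show \<xi>k: "\<xi> k \<in> measurable M D"
    using measurable_compose[OF now proj] by simp
  have law: "distr (distr M ?K ?now) D (\<lambda>p. p k) = D"
    using assms(2) by (simp add: distr_distr comp_def iid_samples_def)
  interpret D: prob_space D
    using prob_space_distr[OF \<xi>k] assms(2) by (simp add: iid_samples_def)
  have "distr M (P k) (past k) \<Otimes>\<^sub>M D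
      = distr (distr M (P k) (past k)) (P k) (\<lambda>p. p) \<Otimes>\<^sub>M distr (distr M ?K ?now) D (\<lambda>p. p k)"
    unfolding law by (simp add: distr_distr comp_def)
  also have "\<dots> = distr (distr M (P k) (past k) \<Otimes>\<^sub>M distr M ?K ?now) (P k \<Otimes>\<^sub>M D) (\<lambda>(p, q). (p, q k))"
    by (rule pair_measure_distr) (simp_all add: law D.sigma_finite_measure_axioms)
  also have "\<dots> = distr M (P k \<Otimes>\<^sub>M D) (\<lambda>\<omega>. (past k \<omega>, \<xi> k \<omega>))"
    unfolding joint by (simp add: distr_distr comp_def)
  finally show "distr M (P k) (past k) \<Otimes>\<^sub>M D = distr M (P k \<Otimes>\<^sub>M D) (\<lambda>\<omega>. (past k \<omega>, \<xi> k \<omega>))" .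
qed

text \<open>Adaptedness in explicit form: the state factors through the first \<open>k\<close>
  samples, so that it can be frozen together with them. The start is deterministic, hence
  \<open>F\<close> is constant for \<open>k = 0\<close>; each step applies \<open>\<Phi>\<close> to
  the restricted past and its newest entry.\<close>

lemma recursion_past_measurable:
  fixes \<xi> :: "nat \<Rightarrow> 'w \<Rightarrow> 's" and s :: "nat \<Rightarrow> 'w \<Rightarrow> 'b"
  assumes \<Phi>[measurable]: "(\<lambda>(p, q). \<Phi> p q) \<in> measurable (N \<Otimes>\<^sub>M D) N"
    and s0: "s0 \<in> space N" "\<And>\<omega>. \<omega> \<in> \<Omega> \<Longrightarrow> s 0 \<omega> = s0"
    and s_Suc: "\<And>k \<omega>. \<omega> \<in> \<Omega> \<Longrightarrow> s (Suc k) \<omega> = \<Phi> (s k \<omega>) (\<xi> k \<omega>)"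
  shows "\<exists>F \<in> measurable (PiM {..<k} (\<lambda>_. D)) N. \<forall>\<omega>\<in>\<Omega>. s k \<omega> = F (\<lambda>i\<in>{..<k}. \<xi> i \<omega>)"
proof (induction k)
  case 0
  show ?case using s0 by (intro bexI[of _ "\<lambda>_. s0"]) auto
next
  case (Suc k)
  then obtain F where F[measurable]: "F \<in> measurable (PiM {..<k} (\<lambda>_. D)) N"
    and sF: "\<And>\<omega>. \<omega> \<in> \<Omega> \<Longrightarrow> s k \<omega> = F (\<lambda>i\<in>{..<k}. \<xi> i \<omega>)" by blast
  have [measurable]: "(\<lambda>p. restrict p {..<k}) \<in> measurable (PiM {..<Suc k} (\<lambda>_. D)) (PiM {..<k} (\<lambda>_. D))"
    by (rule measurable_restrict_subset) auto
  have [measurable]: "(\<lambda>p. p k) \<in> measurable (PiM {..<Suc k} (\<lambda>_. D)) D"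
    by (rule measurable_component_singleton) auto
  have "(\<lambda>p. \<Phi> (F (restrict p {..<k})) (p k)) \<in> measurable (PiM {..<Suc k} (\<lambda>_. D)) N"
    using measurable_compose[OF _ \<Phi>, of "\<lambda>p. (F (restrict p {..<k}), p k)" "PiM {..<Suc k} (\<lambda>_. D)"]
    by simp
  moreover have "s (Suc k) \<omega> = \<Phi> (F (restrict (\<lambda>i\<in>{..<Suc k}. \<xi> i \<omega>) {..<k})) ((\<lambda>i\<in>{..<Suc k}. \<xi> i \<omega>) k)"
    if "\<omega> \<in> \<Omega>" for \<omega>
  proof -
    have "restrict (\<lambda>i\<in>{..<Suc k}. \<xi> i \<omega>) {..<k} = (\<lambda>i\<in>{..<k}. \<xi> i \<omega>)"
      by (auto simp: restrict_def)
    thus ?thesis using s_Suc[OF that] sF[OF that] by (simp only:) simp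
  qed
  ultimately show ?case
    by (intro bexI[of _ "\<lambda>p. \<Phi> (F (restrict p {..<k})) (p k)"] ballI)
qed

section \<open>The bound in expectation\<close>

theorem proposition3p5:
  fixes f :: "real ^ 'n \<Rightarrow> real"
    and xstar x0 :: "real ^ 'n"
    and L \<mu> h w r \<sigma> :: real
    and M :: "'w measure" and D :: "'s measure"
    and \<xi> :: "nat \<Rightarrow> 'w \<Rightarrow> 's"
    and err :: "real ^ 'n \<Rightarrow> 's \<Rightarrow> real ^ 'n"
    and x y v e :: "nat \<Rightarrow> 'w \<Rightarrow> real ^ 'n"
  assumes "\<forall>z. f differentiable (at z)"
    and "strongly_convex \<mu> f"
    and "L > 0" and "L_smooth L f"
    and "\<forall>z. f xstar \<le> f z"
    and "0 < h" and "h \<le> 1 / sqrt L"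
    and "w = h * sqrt \<mu> / (1 + h * sqrt \<mu>)"
    and "r = 1 - h * sqrt \<mu>"
    and "prob_space M"
    and "iid_samples M D \<xi>"
    and "gradient_error D \<sigma> err"
    and "\<forall>\<omega>\<in>space M. x 0 \<omega> = x0 \<and> v 0 \<omega> = x0"
    and "\<forall>k. \<forall>\<omega>\<in>space M. e k \<omega> = err (y k \<omega>) (\<xi> k \<omega>)"
    and "\<forall>k. \<forall>\<omega>\<in>space M. y k \<omega> = (1 - w) *\<^sub>R x k \<omega> + w *\<^sub>R v k \<omega>"
    and "\<forall>k. \<forall>\<omega>\<in>space M. x (Suc k) \<omega> - x k \<omega> =
           w *\<^sub>R (v k \<omega> - x k \<omega>) - (h / sqrt L) *\<^sub>R (grad f (y k \<omega>) + e k \<omega>)"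
    and "\<forall>k. \<forall>\<omega>\<in>space M. v (Suc k) \<omega> - v k \<omega> =
           w *\<^sub>R (x k \<omega> - v k \<omega>) - (h / sqrt \<mu>) *\<^sub>R (grad f (y k \<omega>) + e k \<omega>)"
  shows "\<forall>k. integrable M (\<lambda>\<omega>. E_SC f \<mu> xstar (x k \<omega>) (v k \<omega>)) \<and>
           (LINT \<omega>|M. E_SC f \<mu> xstar (x k \<omega>) (v k \<omega>))
             \<le> r ^ k * E_SC f \<mu> xstar x0 x0 + (1 - r ^ k) * h * (\<sigma>\<^sup>2 / sqrt \<mu>)"
proof -
  note diff = assms(1)[rule_format] and sc = assms(2) and L = assms(3) and sm = assms(4)
    and min = assms(5)[rule_format] and h = assms(6,7) and w = assms(8) and r = assms(9)
    and x0 = assms(13)[rule_format, THEN conjunct1] and v0 = assms(13)[rule_format, THEN conjunct2]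
    and e = assms(14)[rule_format] and y = assms(15)[rule_format]
  interpret prob_space M by fact
  have \<mu>: "\<mu> > 0" using sc by (simp add: strongly_convex_def)
  have rnn: "0 \<le> r" using mult_sqrt_le_one[OF sc sm L h(2)] r by simp
  have w01: "0 \<le> w" "w \<le> 1" using h(1) \<mu> by (auto simp: w divide_le_eq_1 add_pos_pos)
  have f[measurable]: "f \<in> borel_measurable borel"
    using diff by (intro borel_measurable_continuous_onI)
      (simp add: differentiable_imp_continuous_on differentiable_on_def)
  have g[measurable]: "grad f \<in> borel_measurable borel"
    by (rule borel_measurable_grad[OF diff])
  have err_meas: "(\<lambda>(p, s). err p s) \<in> borel_measurable (borel \<Otimes>\<^sub>M D)"
    using assms(12) by (simp add: gradient_error_def)
  \<comment> \<open>The scheme as a Markov recursion on pairs \<open>q = (x, v)\<close>: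
    \<open>Y\<close> is the query point, \<open>u\<close> the coefficient of the error in the
    one-step estimate, \<open>\<Phi>\<close> the transition. Its first component starts from
    \<open>Y q\<close> because \<open>x + w *\<^sub>R (v - x)\<close> is the query point.\<close>
  define Y where "Y q = (1 - w) *\<^sub>R fst q + w *\<^sub>R snd q" for q :: "(real ^ 'n) \<times> (real ^ 'n)"
  define u where "u q = (2 * h\<^sup>2 - h / sqrt L) *\<^sub>R grad f (Y q)
    - (h * sqrt \<mu>) *\<^sub>R (snd q + w *\<^sub>R (fst q - snd q) - xstar)" for q :: "(real ^ 'n) \<times> (real ^ 'n)"
  define \<Phi> where "\<Phi> q s = (Y q - (h / sqrt L) *\<^sub>R (grad f (Y q) + err (Y q) s),
    snd q + w *\<^sub>R (fst q - snd q) - (h / sqrt \<mu>) *\<^sub>R (grad f (Y q) + err (Y q) s))" for q s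
  have Y_meas[measurable]: "Y \<in> borel_measurable (borel \<Otimes>\<^sub>M borel)"
    unfolding Y_def[abs_def] by measurable
  have u_meas[measurable]: "u \<in> borel_measurable (borel \<Otimes>\<^sub>M borel)"
    unfolding u_def[abs_def] by measurable
  have [measurable]: "(\<lambda>(q, s). err (Y q) s) \<in> borel_measurable ((borel \<Otimes>\<^sub>M borel) \<Otimes>\<^sub>M D)"
    using measurable_compose[OF _ err_meas, of "\<lambda>(q, s). (Y q, s)" "(borel \<Otimes>\<^sub>M borel) \<Otimes>\<^sub>M D"]
    by (simp add: case_prod_beta')
  have \<Phi>_meas: "(\<lambda>(q, s). \<Phi> q s) \<in> measurable ((borel \<Otimes>\<^sub>M borel) \<Otimes>\<^sub>M D) (borel \<Otimes>\<^sub>M borel)"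
    unfolding \<Phi>_def case_prod_beta' by measurable
  define Z where "Z k \<omega> = (x k \<omega>, v k \<omega>)" for k \<omega>
  have Z_Suc: "Z (Suc k) \<omega> = \<Phi> (Z k \<omega>) (\<xi> k \<omega>)" if "\<omega> \<in> space M" for k \<omega>
    using assms(16)[rule_format, OF that, of k] assms(17)[rule_format, OF that, of k]
      y[OF that, of k] e[OF that, of k]
    by (simp add: Z_def \<Phi>_def Y_def algebra_simps)
  define En where "En k \<omega> = E_SC f \<mu> xstar (x k \<omega>) (v k \<omega>)" for k \<omega>
  have En_nonneg: "0 \<le> En k \<omega>" for k \<omega>
    using min[of "x k \<omega>"] \<mu> by (simp add: En_def E_SC_def)
  define B where "B k = r ^ k * E_SC f \<mu> xstar x0 x0 + (1 - r ^ k) * h * (\<sigma>\<^sup>2 / sqrt \<mu>)" for k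
  \<comment> \<open>Integrability must be part of the induction: the mean-zero argument at step
    \<open>k\<close> needs \<open>u\<close> square integrable, which comes from integrability of the
    energy.\<close>
  have "integrable M (En k) \<and> (LINT \<omega>|M. En k \<omega>) \<le> B k" for k
  proof (induction k)
    case 0
    have E0: "En 0 \<omega> = E_SC f \<mu> xstar x0 x0" if "\<omega> \<in> space M" for \<omega>
      using x0 v0 that by (simp add: En_def)
    have "integrable M (En 0)" "(LINT \<omega>|M. En 0 \<omega>) = (LINT \<omega>|M. E_SC f \<mu> xstar x0 x0)"
      using E0 by (simp_all cong: Bochner_Integration.integrable_cong Bochner_Integration.integral_cong)
    thus ?case by (simp add: B_def prob_space)
  next
    case (Suc k)
    let ?P = "\<lambda>k. PiM {..<k} (\<lambda>_. D)" and ?past = "\<lambda>k \<omega>. \<lambda>i\<in>{..<k}. \<xi> i \<omega>"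
    have past: "\<exists>F \<in> measurable (?P j) (borel \<Otimes>\<^sub>M borel). \<forall>\<omega>\<in>space M. Z j \<omega> = F (?past j \<omega>)" for j
      using x0 v0 by (intro recursion_past_measurable[OF \<Phi>_meas, of "(x0, x0)"] Z_Suc) (auto simp: Z_def space_pair_measure)
    have past_meas: "?past j \<in> measurable M (?P j)" for j
      by (rule iid_samples_past_indep(1)[OF assms(10,11)])
    have Z_meas: "Z j \<in> measurable M (borel \<Otimes>\<^sub>M borel)" for j
    proof -
      obtain F where "F \<in> measurable (?P j) (borel \<Otimes>\<^sub>M borel)" "\<And>\<omega>. \<omega> \<in> space M \<Longrightarrow> Z j \<omega> = F (?past j \<omega>)"
        using past by blast
      thus ?thesis using measurable_compose[OF past_meas] by (simp cong: measurable_cong)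
    qed
    have En_meas: "En j \<in> borel_measurable M" for j
    proof -
      have "(\<lambda>q. E_SC f \<mu> xstar (fst q) (snd q)) \<in> borel_measurable (borel \<Otimes>\<^sub>M borel)"
        unfolding E_SC_def by measurable
      from measurable_compose[OF Z_meas this] show ?thesis by (simp add: Z_def En_def[abs_def])
    qed
    obtain F where F[measurable]: "F \<in> measurable (?P k) (borel \<Otimes>\<^sub>M borel)"
      and ZF: "\<And>\<omega>. \<omega> \<in> space M \<Longrightarrow> Z k \<omega> = F (?past k \<omega>)" using past by blast
    have u_int: "integrable M (\<lambda>\<omega>. (norm (u (Z k \<omega>)))\<^sup>2)"
    proof (rule Bochner_Integration.integrable_bound)
      let ?C = "2 * ((2 * h\<^sup>2 - h / sqrt L)\<^sup>2 * L\<^sup>2 + (h * sqrt \<mu>)\<^sup>2) * (2 / \<mu>)"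
      show "integrable M (\<lambda>\<omega>. ?C * En k \<omega>)" using Suc by simp
      show "(\<lambda>\<omega>. (norm (u (Z k \<omega>)))\<^sup>2) \<in> borel_measurable M"
        using measurable_compose[OF Z_meas u_meas, of k] by simp
      have "(norm (u (Z k \<omega>)))\<^sup>2 \<le> ?C * En k \<omega>" for \<omega>
        unfolding u_def Z_def En_def fst_conv snd_conv
        by (rule step_coefficient_bound[OF sc sm L min w01]) (simp add: Y_def)
      thus "AE \<omega> in M. norm ((norm (u (Z k \<omega>)))\<^sup>2) \<le> norm (?C * En k \<omega>)"
        by (intro AE_I2) (smt (verit) real_norm_def zero_le_power2)
    qed
    \<comment> \<open>\<open>Z k\<close> and its factorization agree on \<open>space M\<close> only,
      so integrals are transferred by congruence. The extra argument \<open>\<omega>\<close> of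
      \<open>\<psi>\<close> leaves room for the fresh sample.\<close>
    have Z_F: "integrable M (\<lambda>\<omega>. \<psi> (Z k \<omega>) \<omega>) \<longleftrightarrow> integrable M (\<lambda>\<omega>. \<psi> (F (?past k \<omega>)) \<omega>)"
      "(LINT \<omega>|M. \<psi> (Z k \<omega>) \<omega>) = (LINT \<omega>|M. \<psi> (F (?past k \<omega>)) \<omega>)" for \<psi> :: "_ \<Rightarrow> _ \<Rightarrow> real"
      using ZF by (auto intro!: Bochner_Integration.integrable_cong Bochner_Integration.integral_cong)
    have YF: "(\<lambda>p. Y (F p)) \<in> borel_measurable (?P k)" and uF: "(\<lambda>p. u (F p)) \<in> borel_measurable (?P k)"
      by measurable
    have \<xi>_law: "distr M D (\<xi> k) = D" using assms(11) by (simp add: iid_samples_def)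
    have uF_int: "integrable M (\<lambda>\<omega>. (norm (u (F (?past k \<omega>))))\<^sup>2)"
      using u_int Z_F(1)[of "\<lambda>q _. (norm (u q))\<^sup>2"] by simp
    note err_F = gradient_error_independent[where Z="?past k" and Y="\<lambda>p. Y (F p)" and u="\<lambda>p. u (F p)",
        OF assms(10) iid_samples_past_indep(1,2)[OF assms(10,11), of k]
        \<xi>_law iid_samples_past_indep(3)[OF assms(10,11), of k] assms(12) YF uF uF_int]
    let ?e = "\<lambda>\<omega>. err (Y (Z k \<omega>)) (\<xi> k \<omega>)"
    have sq: "integrable M (\<lambda>\<omega>. (norm (?e \<omega>))\<^sup>2)" "(LINT \<omega>|M. (norm (?e \<omega>))\<^sup>2) \<le> \<sigma>\<^sup>2"
      using err_F(1,2) Z_F[of "\<lambda>q \<omega>. (norm (err (Y q) (\<xi> k \<omega>)))\<^sup>2"] by simp_all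
    have cross: "integrable M (\<lambda>\<omega>. inner (u (Z k \<omega>)) (?e \<omega>))" "(LINT \<omega>|M. inner (u (Z k \<omega>)) (?e \<omega>)) = 0"
      using err_F(3,4) Z_F[of "\<lambda>q \<omega>. inner (u q) (err (Y q) (\<xi> k \<omega>))"] by simp_all
    let ?R = "\<lambda>\<omega>. r * En k \<omega> + inner (u (Z k \<omega>)) (?e \<omega>) + h\<^sup>2 * (norm (?e \<omega>))\<^sup>2"
    have step: "En (Suc k) \<omega> \<le> ?R \<omega>" if \<omega>: "\<omega> \<in> space M" for \<omega>
    proof -
      have "Y (Z k \<omega>) = y k \<omega>" "?e \<omega> = e k \<omega>"
        using y[OF \<omega>, of k] e[OF \<omega>, of k] by (simp_all add: Y_def Z_def)
      thus ?thesis
        using E_SC_step[OF sc sm L h w y[OF \<omega>] assms(16)[rule_format, OF \<omega>]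
            assms(17)[rule_format, OF \<omega>], of xstar k]
        by (simp add: En_def u_def r Z_def)
    qed
    have R_int: "integrable M ?R" using Suc sq(1) cross(1) by simp
    \<comment> \<open>Since the energy is nonnegative, the one-sided estimate already bounds its
      absolute value.\<close>
    have Suc_int: "integrable M (En (Suc k))"
    proof (rule Bochner_Integration.integrable_bound[OF R_int En_meas])
      show "AE \<omega> in M. norm (En (Suc k) \<omega>) \<le> norm (?R \<omega>)"
        using step En_nonneg[of "Suc k"] by (intro AE_I2) (smt (verit) real_norm_def)
    qed
    have "(LINT \<omega>|M. En (Suc k) \<omega>) \<le> (LINT \<omega>|M. ?R \<omega>)"
      using Suc_int R_int step by (rule integral_mono)
    also have "\<dots> = r * (LINT \<omega>|M. En k \<omega>) + h\<^sup>2 * (LINT \<omega>|M. (norm (?e \<omega>))\<^sup>2)"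
      using Suc sq(1) cross by simp
    also have "\<dots> \<le> r * B k + h\<^sup>2 * \<sigma>\<^sup>2"
      using Suc sq(2) rnn by (intro add_mono mult_left_mono) auto
    \<comment> \<open>As \<open>1 - r = h * sqrt \<mu>\<close>, the noise
      \<open>h\<^sup>2 * \<sigma>\<^sup>2\<close> equals \<open>(1 - r) * h * c\<close>, so
      \<open>h * c\<close> is the fixed point of the affine recursion that \<open>B\<close>
      solves.\<close>
    also have "\<dots> = B (Suc k)"
    proof -
      define c where "c = \<sigma>\<^sup>2 / sqrt \<mu>"
      have "h\<^sup>2 * \<sigma>\<^sup>2 = (1 - r) * h * c"
        using \<mu> by (simp add: r c_def power2_eq_square)
      thus ?thesis by (simp add: B_def c_def[symmetric] algebra_simps)
    qed
    finally show ?case using Suc_int by simp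
  qed
  thus ?thesis by (simp add: En_def[abs_def] B_def)
qed

end
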